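(* If $(U,R,\mathcal F)$ is a bc-approximation space, then the poset $(\mathfrak C(U,R,\mathcal F),\subseteq)$ of its CF-closed sets is a bc-domain.
   Context: Upper approximation: for a set $U$, a binary relation $R$ on $U$ and $A\subseteq U$, put $\overline R(A)=\{x\in U\mid \exists y\in A,\ xRy\}$. $K\subseteq_{fin}X$ means that $K$ is a finite (possibly empty) subset of $X$, and $\mathcal P_{fin}(U)$ is the set of all finite subsets of $U$. CF-approximation space: a triple $(U,R,\mathcal F)$ with $R$ a transitive relation on the set $U$ and $\emptyset\neq\mathcal F\subseteq\mathcal P_{fin}(U)$ such that for every $F\in\mathcal F$ and every $K\subseteq_{fin}\overline R(F)$ there is $G\in\mathcal F$ with $K\subseteq\overline R(G)$ and $G\subseteq\overline R(F)$. CF-closed set: $E\subseteq U$ such that for every $K\subseteq_{fin}E$ there is $F\in\mathcal F$ with $K\subseteq\overline R(F)\subseteq E$ and $F\subseteq E$. $\mathfrak C(U,R,\mathcal F)$ is the set of all CF-closed sets. Join saturation: $\mathcal F^{\sharp}$ is the set of all unions $\bigcup\mathcal A$ of nonempty finite subfamilies $\mathcal A\subseteq\mathcal F$. bc-approximation space: a CF-approximation space $(U,R,\mathcal F)$ such that for all $M\in\mathcal F^{\sharp}\cup\{\emptyset\}$ and $F\in\mathcal F$ with $M\subseteq\overline R(F)$ there is $G\in\mathcal F$ satisfying: (sL-1) $\overline R(M)\subseteq\overline R(G)\subseteq\overline R(F)$; and (sL-$2'$) for all $G'\in\mathcal F$, $\overline R(M)\subseteq\overline R(G')$ implies $\overline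 R(G)\subseteq\overline R(G')$. Domains: directed sets are nonempty; a dcpo is a poset in which every directed subset has a supremum. $x\ll y$ means that for every directed $D$ having a supremum with $\sup D\geqslant y$ there is $d\in D$ with $x\leqslant d$. A continuous domain is a dcpo in which, for every $x$, the set $\{y\mid y\ll x\}$ is directed with supremum $x$. A bc-domain is a continuous domain in which every subset having an upper bound (including the empty subset) has a supremum. *)

theory Defs
  imports "HOL-Algebra.Lattice"
begin

section \<open>CF-approximation spaces\<close>

definition upper_approx :: "'a set \<Rightarrow> 'a rel \<Rightarrow> 'a set \<Rightarrow> 'a set" where
  "upper_approx U R A = {x \<in> U. \<exists>y\<in>A. (x, y) \<in> R}"

text \<open>\<^term>\<open>Fpow A\<close> is the set of all finite subsets of \<^term>\<open>A\<close>.\<close>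

locale cf_approx_space =
  fixes U :: "'a set" and R :: "'a rel" and \<F> :: "'a set set"
  assumes rel_on: "R \<subseteq> U \<times> U"
    and trans_rel: "trans R"
    and family_nonempty: "\<F> \<noteq> {}"
    and family_finite_subsets: "\<F> \<subseteq> Fpow U"
    and approx: "\<lbrakk>F \<in> \<F>; K \<in> Fpow (upper_approx U R F)\<rbrakk> \<Longrightarrow>
      \<exists>G\<in>\<F>. K \<subseteq> upper_approx U R G \<and> G \<subseteq> upper_approx U R F"

definition cf_closed_sets :: "'a set \<Rightarrow> 'a rel \<Rightarrow> 'a set set \<Rightarrow> 'a set set" where
  "cf_closed_sets U R \<F> = {E. E \<subseteq> U \<and>
     (\<forall>K\<in>Fpow E. \<exists>F\<in>\<F>. K \<subseteq> upper_approx U R F \<and> upper_approx U R F \<subseteq> E \<and> F \<subseteq> E)}"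

definition join_saturation :: "'a set set \<Rightarrow> 'a set set" where
  "join_saturation \<F> = {\<Union>\<A> |\<A>. \<A> \<noteq> {} \<and> finite \<A> \<and> \<A> \<subseteq> \<F>}"

locale bc_approx_space = cf_approx_space +
  assumes bc: "\<lbrakk>M \<in> join_saturation \<F> \<union> {{}}; F \<in> \<F>; M \<subseteq> upper_approx U R F\<rbrakk> \<Longrightarrow>
      \<exists>G\<in>\<F>. upper_approx U R M \<subseteq> upper_approx U R G \<and>
             upper_approx U R G \<subseteq> upper_approx U R F \<and>
             (\<forall>G'\<in>\<F>. upper_approx U R M \<subseteq> upper_approx U R G' \<longrightarrow>
                      upper_approx U R G \<subseteq> upper_approx U R G')"

definition cf_closed_poset :: "'a set \<Rightarrow> 'a rel \<Rightarrow> 'a set set \<Rightarrow> 'a set gorder" where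
  "cf_closed_poset U R \<F> = \<lparr>carrier = cf_closed_sets U R \<F>, eq = (=), le = (\<subseteq>)\<rparr>"

section \<open>Domains\<close>

definition directed_in :: "('a, 'b) gorder_scheme \<Rightarrow> 'a set \<Rightarrow> bool" where
  "directed_in L D \<longleftrightarrow> D \<subseteq> carrier L \<and> D \<noteq> {} \<and>
     (\<forall>x\<in>D. \<forall>y\<in>D. \<exists>z\<in>D. x \<sqsubseteq>\<^bsub>L\<^esub> z \<and> y \<sqsubseteq>\<^bsub>L\<^esub> z)"

text \<open>\<^term>\<open>least L s (Upper L A)\<close> says that \<^term>\<open>s\<close> is the supremum of \<^term>\<open>A\<close> in \<^term>\<open>L\<close>.\<close>

locale dcpo = partial_order +
  assumes directed_sup_exists: "directed_in L D \<Longrightarrow> \<exists>s. least L s (Upper L D)"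

definition way_below :: "('a, 'b) gorder_scheme \<Rightarrow> 'a \<Rightarrow> 'a \<Rightarrow> bool" where
  "way_below L x y \<longleftrightarrow> x \<in> carrier L \<and> y \<in> carrier L \<and>
     (\<forall>D s. directed_in L D \<and> least L s (Upper L D) \<and> y \<sqsubseteq>\<^bsub>L\<^esub> s \<longrightarrow> (\<exists>d\<in>D. x \<sqsubseteq>\<^bsub>L\<^esub> d))"

locale continuous_domain = dcpo +
  assumes way_below_directed: "x \<in> carrier L \<Longrightarrow> directed_in L {y. way_below L y x}"
    and way_below_sup: "x \<in> carrier L \<Longrightarrow> least L x (Upper L {y. way_below L y x})"

text \<open>The empty set is listed separately so that a bc-domain always has a least element: in an
  empty carrier the empty set has no upper bound. For nonempty carriers the disjunct is redundant.\<close>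

locale bc_domain = continuous_domain +
  assumes bounded_sup_exists:
    "\<lbrakk>A \<subseteq> carrier L; A = {} \<or> Upper L A \<noteq> {}\<rbrakk> \<Longrightarrow> \<exists>s. least L s (Upper L A)"

end

(* The sets R(F) with F in the family form a basis of the CF-closed sets: they are CF-closed,
   R(F) is way below E whenever F \<subseteq> E, and every CF-closed set is the directed union of the
   basic sets R(F) with F \<subseteq> E. If a family A of CF-closed sets is bounded, then (sL-2') gives for
   every finite union M \<subseteq> \<Union>A of members of the family a least basic set containing R(M). These
   least basic sets are directed, and their union is the supremum of A. *)

theory Submission
  imports Defs
begin

section \<open>Upper approximations, finite unions and directed families\<close>

lemma upper_approx_mono: "A \<subseteq> B \<Longrightarrow> upper_approx U R A \<subseteq> upper_approx U R B"
  by (auto simp: upper_approx_def)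

text \<open>The empty subfamily has union \<open>{}\<close>, so adjoining \<open>{}\<close> amounts
  to dropping nonemptiness of the subfamily. In this form closure under binary union is
  immediate.\<close>

lemma join_saturation_Un_empty:
  "join_saturation \<F> \<union> {{}} = {\<Union>\<A> |\<A>. finite \<A> \<and> \<A> \<subseteq> \<F>}"
proof (rule Set.set_eqI)
  fix M
  have "(\<exists>\<A>. M = \<Union>\<A> \<and> finite \<A> \<and> \<A> \<subseteq> \<F>) \<longleftrightarrow>
      (\<exists>\<A>. M = \<Union>\<A> \<and> \<A> \<noteq> {} \<and> finite \<A> \<and> \<A> \<subseteq> \<F>) \<or> M = {}"
    by (metis Union_empty empty_subsetI finite.emptyI)
  then show "M \<in> join_saturation \<F> \<union> {{}} \<longleftrightarrow> M \<in> {\<Union>\<A> |\<A>. finite \<A> \<and> \<A> \<subseteq> \<F>}"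
    by (simp add: join_saturation_def disj_commute)
qed

lemma join_saturation_Un:
  assumes "M \<in> join_saturation \<F> \<union> {{}}" "N \<in> join_saturation \<F> \<union> {{}}"
  shows "M \<union> N \<in> join_saturation \<F> \<union> {{}}"
proof -
  obtain \<A> where \<A>: "M = \<Union>\<A>" "finite \<A>" "\<A> \<subseteq> \<F>"
    using assms(1) unfolding join_saturation_Un_empty by auto
  obtain \<B> where \<B>: "N = \<Union>\<B>" "finite \<B>" "\<B> \<subseteq> \<F>"
    using assms(2) unfolding join_saturation_Un_empty by auto
  have "M \<union> N = \<Union>(\<A> \<union> \<B>) \<and> finite (\<A> \<union> \<B>) \<and> \<A> \<union> \<B> \<subseteq> \<F>"
    using \<A> \<B> by simp
  then show ?thesis
    unfolding join_saturation_Un_empty by (intro CollectI) (rule exI)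
qed

lemma join_saturation_superset: "F \<in> \<F> \<Longrightarrow> F \<in> join_saturation \<F>"
  unfolding join_saturation_def by (rule CollectI, rule exI[of _ "{F}"]) simp

text \<open>Finite sets are compact for directed unions: in the induction, directedness absorbs one
  more point at a time.\<close>

lemma finite_subset_directed_Union:
  assumes "finite K" "K \<subseteq> \<Union>D" "D \<noteq> {}"
    and "\<And>x y. x \<in> D \<Longrightarrow> y \<in> D \<Longrightarrow> \<exists>z\<in>D. x \<subseteq> z \<and> y \<subseteq> z"
  shows "\<exists>d\<in>D. K \<subseteq> d"
  using assms(1,2)
proof (induction K)
  case empty
  then show ?case using assms(3) by blast
next
  case (insert a K)
  then obtain d e where "d \<in> D" "K \<subseteq> d" "e \<in> D" "a \<in> e" by auto
  with assms(4)[of d e] show ?case by blast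
qed

lemma carrier_cf_closed_poset [simp]:
    "carrier (cf_closed_poset U R \<F>) = cf_closed_sets U R \<F>"
  and le_cf_closed_poset [simp]: "x \<sqsubseteq>\<^bsub>cf_closed_poset U R \<F>\<^esub> y \<longleftrightarrow> x \<subseteq> y"
  by (simp_all add: cf_closed_poset_def)

lemma partial_order_cf_closed_poset: "partial_order (cf_closed_poset U R \<F>)"
  by unfold_locales (auto simp: cf_closed_poset_def)

lemma directed_in_cf_closed_poset:
  "directed_in (cf_closed_poset U R \<F>) D \<longleftrightarrow> D \<subseteq> cf_closed_sets U R \<F> \<and> D \<noteq> {} \<and>
     (\<forall>x\<in>D. \<forall>y\<in>D. \<exists>z\<in>D. x \<subseteq> z \<and> y \<subseteq> z)"
  by (simp add: directed_in_def)

lemma Upper_cf_closed_poset: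
  assumes "A \<subseteq> cf_closed_sets U R \<F>"
  shows "Upper (cf_closed_poset U R \<F>) A = {E \<in> cf_closed_sets U R \<F>. \<Union>A \<subseteq> E}"
  using assms by (auto simp: Upper_def)

lemma least_Upper_cf_closed_poset:
  assumes "A \<subseteq> cf_closed_sets U R \<F>"
  shows "least (cf_closed_poset U R \<F>) s (Upper (cf_closed_poset U R \<F>) A) \<longleftrightarrow>
    s \<in> cf_closed_sets U R \<F> \<and> \<Union>A \<subseteq> s \<and>
    (\<forall>E\<in>cf_closed_sets U R \<F>. \<Union>A \<subseteq> E \<longrightarrow> s \<subseteq> E)"
  unfolding Upper_cf_closed_poset[OF assms] least_def by auto

section \<open>Continuity of the poset of CF-closed sets\<close>

context cf_approx_space
begin

abbreviation up :: "'a set \<Rightarrow> 'a set" where "up \<equiv> upper_approx U R"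
abbreviation CF :: "'a set set" where "CF \<equiv> cf_closed_sets U R \<F>"
abbreviation P :: "'a set gorder" where "P \<equiv> cf_closed_poset U R \<F>"

text \<open>This is where transitivity enters: x R a with a in \<open>A\<close>, and a R b with b in
  \<open>B\<close>, give x R b.\<close>

lemma up_subset_up: "A \<subseteq> up B \<Longrightarrow> up A \<subseteq> up B"
  using trans_rel by (fastforce simp: upper_approx_def dest: transD)

lemma family_finite: "F \<in> \<F> \<Longrightarrow> finite F"
  using family_finite_subsets by (auto simp: Fpow_def)

lemma cf_closedD:
  assumes "E \<in> CF" "finite K" "K \<subseteq> E"
  shows "\<exists>F\<in>\<F>. K \<subseteq> up F \<and> up F \<subseteq> E \<and> F \<subseteq> E"
  using assms by (auto simp: cf_closed_sets_def Fpow_def)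

lemma up_subset_cf_closed:
  assumes "E \<in> CF" "finite M" "M \<subseteq> E"
  shows "up M \<subseteq> E"
  using cf_closedD[OF assms] up_subset_up by blast

text \<open>The approximation axiom yields \<open>G\<close> with \<open>K\<close> inside
  \<open>up G\<close> and \<open>G\<close> inside \<open>up F\<close>; transitivity adds that
  \<open>up G\<close> lies in \<open>up F\<close>.\<close>

lemma up_cf_closed:
  assumes "F \<in> \<F>"
  shows "up F \<in> CF"
proof -
  have "up F \<subseteq> U" by (auto simp: upper_approx_def)
  moreover have "\<exists>G\<in>\<F>. K \<subseteq> up G \<and> up G \<subseteq> up F \<and> G \<subseteq> up F" if "K \<in> Fpow (up F)" for K
    using approx[OF assms that] up_subset_up by blast
  ultimately show ?thesis by (simp add: cf_closed_sets_def)
qed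

text \<open>A finite subset of the union already lies in one member of \<open>D\<close>, and the
  witness for that member also serves for the union.\<close>

lemma directed_Union_cf_closed:
  assumes "directed_in P D"
  shows "\<Union>D \<in> CF"
proof -
  have D: "D \<subseteq> CF" "D \<noteq> {}" "\<And>x y. x \<in> D \<Longrightarrow> y \<in> D \<Longrightarrow> \<exists>z\<in>D. x \<subseteq> z \<and> y \<subseteq> z"
    using assms by (auto simp: directed_in_cf_closed_poset)
  have "\<exists>F\<in>\<F>. K \<subseteq> up F \<and> up F \<subseteq> \<Union>D \<and> F \<subseteq> \<Union>D" if "K \<in> Fpow (\<Union>D)" for K
  proof -
    have K: "finite K" "K \<subseteq> \<Union>D" using that by (auto simp: Fpow_def)
    obtain d where d: "d \<in> D" "K \<subseteq> d"
      using finite_subset_directed_Union[OF K D(2,3)] by blast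
    then have "d \<in> CF" using D(1) by blast
    from cf_closedD[OF this K(1) d(2)] show ?thesis using d(1) by blast
  qed
  moreover have "\<Union>D \<subseteq> U" using D(1) by (auto simp: cf_closed_sets_def)
  ultimately show ?thesis by (simp add: cf_closed_sets_def)
qed

lemma directed_sup_iff_Union:
  assumes "directed_in P D"
  shows "least P s (Upper P D) \<longleftrightarrow> s = \<Union>D"
proof -
  have "D \<subseteq> CF" using assms by (simp add: directed_in_cf_closed_poset)
  then show ?thesis
    using directed_Union_cf_closed[OF assms] by (auto simp: least_Upper_cf_closed_poset)
qed

lemma dcpo_cf_closed_poset: "dcpo P"
proof -
  interpret partial_order P by (rule partial_order_cf_closed_poset)
  show ?thesis by unfold_locales (auto simp: directed_sup_iff_Union)
qed

lemma up_directed: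
  assumes "E \<in> CF"
  shows "directed_in P (up ` {F \<in> \<F>. F \<subseteq> E})" and "\<Union>(up ` {F \<in> \<F>. F \<subseteq> E}) = E"
proof -
  show "directed_in P (up ` {F \<in> \<F>. F \<subseteq> E})"
    unfolding directed_in_cf_closed_poset
  proof (intro conjI ballI)
    show "up ` {F \<in> \<F>. F \<subseteq> E} \<subseteq> CF" using up_cf_closed by auto
    \<comment> \<open>Closedness at K = \<open>{}\<close> puts some member of the family inside
      \<open>E\<close>, even if \<open>E\<close> is empty.\<close>
    show "up ` {F \<in> \<F>. F \<subseteq> E} \<noteq> {}" using cf_closedD[OF assms, of "{}"] by auto
    fix x y assume "x \<in> up ` {F \<in> \<F>. F \<subseteq> E}" "y \<in> up ` {F \<in> \<F>. F \<subseteq> E}"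
    then obtain F G where FG: "F \<in> \<F>" "F \<subseteq> E" "G \<in> \<F>" "G \<subseteq> E" and xy: "x = up F" "y = up G"
      by auto
    \<comment> \<open>Members of the family are finite, so closedness applies to the union and one
      \<open>H\<close> dominates both.\<close>
    have "finite (F \<union> G)" "F \<union> G \<subseteq> E" using FG family_finite by auto
    from cf_closedD[OF assms this] obtain H where H: "H \<in> \<F>" "F \<union> G \<subseteq> up H" "H \<subseteq> E"
      by auto
    then have "x \<subseteq> up H" "y \<subseteq> up H" using up_subset_up xy by simp_all
    then show "\<exists>z\<in>up ` {F \<in> \<F>. F \<subseteq> E}. x \<subseteq> z \<and> y \<subseteq> z" using H by auto
  qed
  show "\<Union>(up ` {F \<in> \<F>. F \<subseteq> E}) = E"
  proof
    show "\<Union>(up ` {F \<in> \<F>. F \<subseteq> E}) \<subseteq> E"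
      using up_subset_cf_closed[OF assms] family_finite by (simp add: UN_subset_iff)
    show "E \<subseteq> \<Union>(up ` {F \<in> \<F>. F \<subseteq> E})"
    proof
      fix x assume "x \<in> E"
      then show "x \<in> \<Union>(up ` {F \<in> \<F>. F \<subseteq> E})"
        using cf_closedD[OF assms, of "{x}"] by auto
    qed
  qed
qed

text \<open>Forwards, the relation is tested on the directed family of basic sets with union
  \<open>E\<close>. Backwards, the finite set \<open>F\<close> lies in a single member of any
  directed \<open>D\<close> whose supremum contains \<open>E\<close>, and that member, being
  CF-closed, contains \<open>up F\<close>.\<close>

lemma way_below_iff:
  assumes "E \<in> CF"
  shows "way_below P Y E \<longleftrightarrow> Y \<in> CF \<and> (\<exists>F\<in>\<F>. F \<subseteq> E \<and> Y \<subseteq> up F)"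
proof (intro iffI conjI)
  assume wb: "way_below P Y E"
  then show "Y \<in> CF" by (simp add: way_below_def)
  have "least P E (Upper P (up ` {F \<in> \<F>. F \<subseteq> E}))"
    using up_directed[OF assms] by (simp add: directed_sup_iff_Union)
  then have "\<exists>d\<in>up ` {F \<in> \<F>. F \<subseteq> E}. Y \<subseteq> d"
    using wb up_directed(1)[OF assms] by (fastforce simp: way_below_def)
  then show "\<exists>F\<in>\<F>. F \<subseteq> E \<and> Y \<subseteq> up F" by blast
next
  assume "Y \<in> CF \<and> (\<exists>F\<in>\<F>. F \<subseteq> E \<and> Y \<subseteq> up F)"
  then obtain F where Y: "Y \<in> CF" and F: "F \<in> \<F>" "F \<subseteq> E" "Y \<subseteq> up F" by blast
  have "\<exists>d\<in>D. Y \<subseteq> d" if "directed_in P D" "least P s (Upper P D)" "E \<subseteq> s" for D s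
  proof -
    have D: "D \<subseteq> CF" "D \<noteq> {}" "\<And>x y. x \<in> D \<Longrightarrow> y \<in> D \<Longrightarrow> \<exists>z\<in>D. x \<subseteq> z \<and> y \<subseteq> z"
      using that(1) by (auto simp: directed_in_cf_closed_poset)
    have "F \<subseteq> \<Union>D" using that F(2) by (auto simp: directed_sup_iff_Union)
    from finite_subset_directed_Union[OF family_finite[OF F(1)] this D(2,3)]
    obtain d where "d \<in> D" "F \<subseteq> d" by blast
    moreover from this have "up F \<subseteq> d"
      using up_subset_cf_closed D(1) family_finite[OF F(1)] by blast
    ultimately show ?thesis using F(3) by blast
  qed
  then show "way_below P Y E" using Y assms by (auto simp: way_below_def)
qed

lemma continuous_domain_cf_closed_poset: "continuous_domain P"
proof -
  interpret dcpo P by (rule dcpo_cf_closed_poset)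
  have dir: "directed_in P {Y. way_below P Y E}" and sup: "\<Union>{Y. way_below P Y E} = E"
    if E: "E \<in> CF" for E
  proof -
    define B where "B = up ` {F \<in> \<F>. F \<subseteq> E}"
    define W where "W = {Y. way_below P Y E}"
    have B: "B \<subseteq> CF" "B \<noteq> {}" "\<forall>x\<in>B. \<forall>y\<in>B. \<exists>z\<in>B. x \<subseteq> z \<and> y \<subseteq> z"
      using up_directed(1)[OF E, folded B_def] by (simp_all add: directed_in_cf_closed_poset)
    \<comment> \<open>\<open>W\<close> is the down-closure of \<open>B\<close> among the CF-closed
      sets, so it inherits directedness and the union \<open>E\<close> from
      \<open>B\<close>.\<close>
    have W: "Y \<in> W \<longleftrightarrow> Y \<in> CF \<and> (\<exists>b\<in>B. Y \<subseteq> b)" for Y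
      by (auto simp: way_below_iff[OF E] B_def W_def)
    have BW: "B \<subseteq> W" using B(1) W by auto
    have "\<exists>Z\<in>W. X \<subseteq> Z \<and> Y \<subseteq> Z" if XY: "X \<in> W" "Y \<in> W" for X Y
    proof -
      obtain b c where bc: "b \<in> B" "X \<subseteq> b" "c \<in> B" "Y \<subseteq> c" using XY W by auto
      then obtain z where "z \<in> B" "b \<subseteq> z" "c \<subseteq> z" using B(3) by meson
      with bc BW show ?thesis by (meson subsetD subset_trans)
    qed
    then have "directed_in P W"
      using B(2) BW W unfolding directed_in_cf_closed_poset by auto
    then show "directed_in P {Y. way_below P Y E}" by (simp add: W_def)
    have "\<Union>W = \<Union>B" using BW W by blast
    then show "\<Union>{Y. way_below P Y E} = E"
      using up_directed(2)[OF E] by (simp add: B_def W_def)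
  qed
  show ?thesis
    using dir sup by unfold_locales (simp_all add: directed_sup_iff_Union)
qed

end

section \<open>Suprema of bounded families\<close>

context bc_approx_space
begin

lemma bounded_sup:
  assumes A: "A \<subseteq> CF" and H: "H \<in> CF" "\<Union>A \<subseteq> H"
  shows "\<exists>s. least P s (Upper P A)"
proof -
  let ?J = "join_saturation \<F> \<union> {{}}"
  \<comment> \<open>Only \<open>up G\<close> is determined by \<open>M\<close>, not \<open>G\<close>
    itself; hence \<open>D\<close> collects the sets \<open>up G\<close> over all admissible
    \<open>G\<close>, without choosing one.\<close>
  define lst where "lst M G \<longleftrightarrow> G \<in> \<F> \<and> up M \<subseteq> up G \<and>
    (\<forall>G'\<in>\<F>. up M \<subseteq> up G' \<longrightarrow> up G \<subseteq> up G')" for M G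
  define D where "D = {up G | G. \<exists>M\<in>?J. M \<subseteq> \<Union>A \<and> lst M G}"
  have J_fin: "finite M" if "M \<in> ?J" for M
    using that family_finite by (auto simp: join_saturation_def intro!: finite_Union)
  \<comment> \<open>The bound \<open>H\<close> supplies the \<open>F\<close> with \<open>M\<close>
    inside \<open>up F\<close> that the axiom \<open>bc\<close> asks for.\<close>
  have ex: "\<exists>G. lst M G" if M: "M \<in> ?J" "M \<subseteq> \<Union>A" for M
  proof -
    have "M \<subseteq> H" using M(2) H(2) by blast
    then obtain F where "F \<in> \<F>" "M \<subseteq> up F"
      using cf_closedD[OF H(1) J_fin[OF M(1)]] by blast
    from bc[OF M(1) this] show ?thesis unfolding lst_def by blast
  qed
  \<comment> \<open>Each upper bound \<open>E\<close> has its own basic set \<open>up F\<close>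
    around \<open>M\<close>; leastness of \<open>up G\<close> compares it with all of them.\<close>
  have up_bound: "up G \<subseteq> E"
    if M: "M \<in> ?J" "M \<subseteq> \<Union>A" "lst M G" "E \<in> CF" "\<Union>A \<subseteq> E" for M G E
  proof -
    have "M \<subseteq> E" using M(2,5) by blast
    then obtain F where F: "F \<in> \<F>" "M \<subseteq> up F" "up F \<subseteq> E"
      using cf_closedD[OF M(4) J_fin[OF M(1)]] by blast
    then have "up G \<subseteq> up F" using M(3) up_subset_up unfolding lst_def by blast
    with F(3) show ?thesis by blast
  qed
  have dir: "directed_in P D"
    unfolding directed_in_cf_closed_poset
  proof (intro conjI ballI)
    show "D \<subseteq> CF" unfolding D_def lst_def using up_cf_closed by blast
    \<comment> \<open>M = \<open>{}\<close> is always admissible, also when \<open>A\<close> is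
      empty.\<close>
    show "D \<noteq> {}" unfolding D_def using ex[of "{}"] by blast
    fix x y assume "x \<in> D" "y \<in> D"
    then obtain M N G G' where MN: "M \<in> ?J" "N \<in> ?J" "M \<subseteq> \<Union>A" "N \<subseteq> \<Union>A"
      and lst: "lst M G" "lst N G'" and xy: "x = up G" "y = up G'"
      unfolding D_def by blast
    have MN': "M \<union> N \<in> ?J" "M \<union> N \<subseteq> \<Union>A"
      using join_saturation_Un[OF MN(1,2)] MN(3,4) by auto
    then obtain G'' where G'': "lst (M \<union> N) G''" using ex by blast
    have "up M \<subseteq> up G''" "up N \<subseteq> up G''"
      using G'' upper_approx_mono[of M "M \<union> N"] upper_approx_mono[of N "M \<union> N"]
      unfolding lst_def by blast+
    \<comment> \<open>\<open>up G''\<close> contains both \<open>up M\<close> and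
      \<open>up N\<close>, so it competes in the leastness of \<open>up G\<close> and of
      \<open>up G'\<close>.\<close>
    then have "x \<subseteq> up G''" "y \<subseteq> up G''" using lst G'' unfolding lst_def xy by blast+
    moreover have "up G'' \<in> D" unfolding D_def using MN' G'' by blast
    ultimately show "\<exists>z\<in>D. x \<subseteq> z \<and> y \<subseteq> z" by blast
  qed
  have "\<Union>A \<subseteq> \<Union>D"
  proof
    fix x assume "x \<in> \<Union>A"
    then obtain E where E: "E \<in> A" "x \<in> E" by blast
    then have "E \<in> CF" using A by blast
    then obtain F where F: "F \<in> \<F>" "x \<in> up F" "F \<subseteq> E"
      using cf_closedD[of E "{x}"] E(2) by auto
    \<comment> \<open>Taking M = \<open>F\<close> gives a member of \<open>D\<close> that contains
      \<open>up F\<close>, hence \<open>x\<close>.\<close>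
    then have FJ: "F \<in> ?J" "F \<subseteq> \<Union>A" using join_saturation_superset E(1) by auto
    then obtain G where "lst F G" using ex by blast
    then have "x \<in> up G" "up G \<in> D" using F(2) FJ unfolding D_def lst_def by blast+
    then show "x \<in> \<Union>D" by blast
  qed
  moreover have "\<Union>D \<subseteq> E" if "E \<in> CF" "\<Union>A \<subseteq> E" for E
    using up_bound that unfolding D_def by blast
  ultimately have "least P (\<Union>D) (Upper P A)"
    using directed_Union_cf_closed[OF dir] by (simp add: least_Upper_cf_closed_poset[OF A])
  then show ?thesis ..
qed

lemma bc_domain_cf_closed_poset: "bc_domain P"
proof -
  interpret continuous_domain P by (rule continuous_domain_cf_closed_poset)
  \<comment> \<open>For empty \<open>A\<close> the set \<open>up F\<close> plays the bound
    \<open>H\<close>; otherwise \<open>H\<close> comes from \<open>Upper P A\<close>.\<close>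
  obtain F where "F \<in> \<F>" using family_nonempty by blast
  then have "up F \<in> CF" by (rule up_cf_closed)
  then have "\<exists>s. least P s (Upper P A)" if "A \<subseteq> CF" "A = {} \<or> Upper P A \<noteq> {}" for A
    using bounded_sup[OF that(1)] that by (auto simp: Upper_cf_closed_poset)
  then show ?thesis by unfold_locales simp
qed

end

theorem theorem5p8:
  fixes U :: "'a set" and R :: "'a rel" and \<F> :: "'a set set"
  assumes "bc_approx_space U R \<F>"
  shows "bc_domain (cf_closed_poset U R \<F>)"
  using assms by (rule bc_approx_space.bc_domain_cf_closed_poset)

end
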